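(* For every integer $d\ge 3$ there is a Borel measurable function $V$ on $\mathbb{R}^d$, with values in $[-\infty,\infty]$, such that the Schrödinger perturbation $G$ of the Gauss-Weierstrass kernel $g$ by $V$ satisfies, for some numbers $0<c_1\le c_2<\infty$, $$c_1\le\frac{G(t,x,y)}{g(t,x,y)}\le c_2,\qquad t>0,\ x,y\in\mathbb{R}^d,$$ but $V\notin L^1(\mathbb{R}^d)\cup\bigcup_{p>1}L^p_{loc}(\mathbb{R}^d)$, i.e. $V\notin L^1(\mathbb{R}^d)$ and $V\notin L^p_{loc}(\mathbb{R}^d)$ for every $p>1$.
   Context: The Gauss-Weierstrass kernel on $\mathbb{R}^d$ is $g(t,x,y)=(4\pi t)^{-d/2}e^{-|y-x|^2/(4t)}$, $t>0$, $x,y\in\mathbb{R}^d$. The Schrödinger perturbation $G$ of $g$ by $V$ (the fundamental solution of $\partial_t=\Delta+V$) is given by the perturbation series $G(t,x,y)=\sum_{n=0}^\infty g_n(t,x,y)$, where $g_0=g$ and $$g_n(t,x,y)=\int_0^t\int_{\mathbb{R}^d}g_{n-1}(s,x,z)V(z)g(t-s,z,y)\,dz\,ds,\qquad n\ge 1 .$$ Here it is understood that the integrals and the series converge absolutely, i.e. that the series with $V$ replaced by $|V|$ is finite for all $t>0$, $x,y\in\mathbb{R}^d$. In particular $G$ satisfies the Duhamel formula $G(t,x,y)=g(t,x,y)+\int_0^t\int_{\mathbb{R}^d}G(s,x,z)V(z)g(t-s,z,y)\,dz\,ds$. *)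

theory Defs
  imports "HOL-Analysis.Analysis"
begin

definition gauss_kernel :: "real \<Rightarrow> 'a::euclidean_space \<Rightarrow> 'a \<Rightarrow> real" where
  "gauss_kernel t x y =
     (4 * pi * t) powr (- real DIM('a) / 2) * exp (- (norm (y - x))\<^sup>2 / (4 * t))"

text \<open>
  The terms of the perturbation series for a nonnegative potential, in particular for
  the absolute value of a signed one; as integrals of nonnegative functions they always
  exist, possibly with value infinity.
\<close>

primrec perturbation_term_nn ::
    "('a::euclidean_space \<Rightarrow> ennreal) \<Rightarrow> nat \<Rightarrow> real \<Rightarrow> 'a \<Rightarrow> 'a \<Rightarrow> ennreal" where
  "perturbation_term_nn W 0 t x y = ennreal (gauss_kernel t x y)"
| "perturbation_term_nn W (Suc n) t x y =
     (\<integral>\<^sup>+ s\<in>{0<..<t}. (\<integral>\<^sup>+ z. perturbation_term_nn W n s x z * W z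
        * ennreal (gauss_kernel (t - s) z y) \<partial>lborel) \<partial>lborel)"

definition perturbation_series_converges_absolutely ::
    "('a::euclidean_space \<Rightarrow> ereal) \<Rightarrow> bool" where
  "perturbation_series_converges_absolutely V \<longleftrightarrow>
     (\<forall>t>0. \<forall>x y. (\<Sum>n. perturbation_term_nn (\<lambda>z. e2ennreal \<bar>V z\<bar>) n t x y) < \<infinity>)"

text \<open>
  The terms and the sum of the signed series.  They are meaningful only under absolute
  convergence.  In that case finiteness of the term with \<open>n = 1\<close> forces \<open>V\<close> to be finite
  almost everywhere, because the Gaussian kernel is strictly positive; hence the value
  \<open>0\<close> that \<^const>\<open>real_of_ereal\<close> assigns to infinite arguments does not affect the integrals.
\<close>

primrec perturbation_term ::
    "('a::euclidean_space \<Rightarrow> ereal) \<Rightarrow> nat \<Rightarrow> real \<Rightarrow> 'a \<Rightarrow> 'a \<Rightarrow> real" where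
  "perturbation_term V 0 t x y = gauss_kernel t x y"
| "perturbation_term V (Suc n) t x y =
     (LINT s:{0<..<t}|lborel. (LINT z|lborel. perturbation_term V n s x z * real_of_ereal (V z)
        * gauss_kernel (t - s) z y))"

definition schroedinger_perturbation ::
    "('a::euclidean_space \<Rightarrow> ereal) \<Rightarrow> real \<Rightarrow> 'a \<Rightarrow> 'a \<Rightarrow> real" where
  "schroedinger_perturbation V t x y = (\<Sum>n. perturbation_term V n t x y)"

text \<open>The power \<open>|x|\<close> to the \<open>p\<close>, for \<open>p > 0\<close>.\<close>

definition abs_powr :: "ereal \<Rightarrow> real \<Rightarrow> ennreal" where
  "abs_powr x p = (if \<bar>x\<bar> = \<infinity> then \<infinity> else ennreal (\<bar>real_of_ereal x\<bar> powr p))"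

definition Lp_on :: "real \<Rightarrow> 'a::euclidean_space set \<Rightarrow> ('a \<Rightarrow> ereal) set" where
  "Lp_on p A = {f \<in> borel_measurable borel. (\<integral>\<^sup>+ x\<in>A. abs_powr (f x) p \<partial>lborel) < \<infinity>}"

definition Lp_loc :: "real \<Rightarrow> ('a::euclidean_space \<Rightarrow> ereal) set" where
  "Lp_loc p = {f. \<forall>K. compact K \<longrightarrow> f \<in> Lp_on p K}"

end

theory Submission
  imports Defs "HOL-Probability.Distributions" "HOL-Real_Asymp.Real_Asymp"
begin

text \<open>
  For a nonnegative potential \<open>W\<close> it suffices that the first term \<open>g\<^sub>1\<close> of the series is at most
  \<open>g / 2\<close>: then \<open>g\<^sub>n \<le> 2^(-n) g\<close> and \<open>1 \<le> G / g \<le> 2\<close>. By the Brownian bridge identity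
  \<open>g(s,x,z) g(t-s,z,y) = g(t,x,y) g(\<tau>,m,z)\<close> with \<open>\<tau> = s (t-s) / t\<close> and \<open>m\<close> on the segment
  from \<open>x\<close> to \<open>y\<close>, this is a bound on Gaussian averages of \<open>W\<close>, integrated over \<open>s\<close>. For
  \<open>W(z) = c f(z\<^sub>1) 1(0 < z\<^sub>2 < 1) z\<^sub>3^(-1/2) 1(z\<^sub>3 > 0)\<close> with \<open>f \<in> L\<^sup>1(\<real>)\<close> the averages factorise, and the three
  factors are of order \<open>\<tau>^(-1/2)\<close>, \<open>min 1 \<tau>^(-1/2)\<close> and \<open>\<tau>^(-1/4)\<close>, uniformly in \<open>m\<close>. Their product is of order
  \<open>min \<tau>^(-3/4) \<tau>^(-5/4)\<close>, which is integrable both for short and for long times; this is where three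
  dimensions are needed. The slow decay in \<open>z\<^sub>3\<close> prevents \<open>W \<in> L\<^sup>1\<close>, and \<open>f\<close> is chosen in no
  \<open>L\<^sup>p\<close> with \<open>p > 1\<close> near \<open>0\<close>: the spikes of mass \<open>2^(-k-1)\<close> live on intervals whose lengths \<open>2^(-k*k)\<close>
  decay superexponentially.
\<close>

section \<open>The Gaussian kernel: bridge identity, factorisation, one-dimensional bounds\<close>

lemma gauss_kernel_nonneg: "0 \<le> gauss_kernel t x y"
  by (simp add: gauss_kernel_def)

lemma gauss_kernel_pos: "t > 0 \<Longrightarrow> 0 < gauss_kernel t x y"
  by (simp add: gauss_kernel_def)

lemma gauss_kernel_measurable [measurable]:
  assumes [measurable]: "f \<in> borel_measurable M" "g \<in> borel_measurable M" "h \<in> borel_measurable M"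
  shows "(\<lambda>u. gauss_kernel (f u) (g u) (h u)) \<in> borel_measurable M"
  unfolding gauss_kernel_def by measurable

text \<open>Complete the square in \<open>z\<close>: the exponents combine to a Gaussian centred on
  the segment from \<open>x\<close> to \<open>y\<close>, and the prefactors match because
  \<open>s * (t - s)\<close> is \<open>t\<close> times the bridge time
  \<open>s * (t - s) / t\<close>.\<close>

lemma gauss_kernel_bridge:
  fixes x y z :: "'a::euclidean_space"
  assumes "0 < s" "s < t"
  shows "gauss_kernel s x z * gauss_kernel (t - s) z y =
    gauss_kernel t x y * gauss_kernel (s * (t - s) / t) (x + (s / t) *\<^sub>R (y - x)) z"
proof -
  have t: "0 < t" "0 < t - s" using assms by auto
  define a where "a = z - x"
  define b where "b = y - x"
  have "(4 * pi * s) powr p * (4 * pi * (t - s)) powr p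
      = (4 * pi * t) powr p * (4 * pi * (s * (t - s) / t)) powr p" for p
    using assms t by (simp flip: powr_mult) (simp add: field_simps)
  moreover have "(norm a)\<^sup>2 / (4 * s) + (norm (b - a))\<^sup>2 / (4 * (t - s))
      = (norm b)\<^sup>2 / (4 * t) + (norm (a - (s / t) *\<^sub>R b))\<^sup>2 / (4 * (s * (t - s) / t))"
  proof -
    \<comment> \<open>In terms of the three inner products the claim becomes a rational
      identity.\<close>
    define A B C where "A = a \<bullet> a" and "B = a \<bullet> b" and "C = b \<bullet> b"
    have "A / (4 * s) + (C - 2 * B + A) / (4 * (t - s))
      = C / (4 * t) + (A - 2 * (s / t) * B + (s / t)\<^sup>2 * C) / (4 * (s * (t - s) / t))"
      using assms t by (simp add: divide_simps) (simp add: algebra_simps power2_eq_square)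
    then show ?thesis
      unfolding A_def B_def C_def power2_norm_eq_inner
      by (simp add: inner_diff inner_commute power2_eq_square algebra_simps)
  qed
  ultimately show ?thesis
    by (simp add: gauss_kernel_def a_def b_def algebra_simps exp_add [symmetric])
qed

lemma gauss_kernel_eq_prod:
  fixes x y :: "'a::euclidean_space"
  assumes "t > 0"
  shows "gauss_kernel t x y = (\<Prod>b\<in>Basis. gauss_kernel t (x \<bullet> b) (y \<bullet> b))"
proof -
  have "(norm (y - x))\<^sup>2 = (\<Sum>b\<in>Basis. (y \<bullet> b - x \<bullet> b)\<^sup>2)"
    unfolding power2_norm_eq_inner by (subst euclidean_inner) (simp add: power2_eq_square inner_diff_left)
  then show ?thesis
    using assms
    by (simp add: gauss_kernel_def prod.distrib exp_sum [symmetric] sum_negf sum_divide_distrib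
        powr_realpow [symmetric] powr_powr field_simps flip: powr_realpow)
qed

lemma nn_integral_gauss_kernel_real:
  assumes "t > 0"
  shows "(\<integral>\<^sup>+ r. ennreal (gauss_kernel t a (r::real)) \<partial>lborel) = 1"
proof -
  have "gauss_kernel t a = normal_density a (sqrt (2 * t))"
    using assms by (auto simp: gauss_kernel_def normal_density_def powr_minus powr_half_sqrt divide_simps)
  then show ?thesis
    using assms by (simp add: nn_integral_eq_integral normal_density_nonneg)
qed

lemma gauss_kernel_real_le:
  assumes "t > 0"
  shows "gauss_kernel t a (r::real) \<le> t powr (-1/2)"
proof -
  have "(4 * pi * t) powr (-1/2) \<le> t powr (-1/2)"
    using assms pi_gt3 by (intro powr_mono2') (auto simp: field_simps)
  moreover have "exp (- (norm (r - a))\<^sup>2 / (4 * t)) \<le> 1"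
    using assms by simp
  ultimately have "(4 * pi * t) powr (-1/2) * exp (- (norm (r - a))\<^sup>2 / (4 * t)) \<le> t powr (-1/2) * 1"
    by (intro mult_mono) auto
  then show ?thesis by (simp add: gauss_kernel_def)
qed

lemma nn_integral_gauss_kernel_le:
  fixes f :: "real \<Rightarrow> ennreal"
  assumes "t > 0" and [measurable]: "f \<in> borel_measurable borel"
  shows "(\<integral>\<^sup>+ r. ennreal (gauss_kernel t a r) * f r \<partial>lborel) \<le> ennreal (t powr (-1/2)) * (\<integral>\<^sup>+ r. f r \<partial>lborel)"
  unfolding nn_integral_cmult [OF assms(2)[unfolded measurable_lborel2 [symmetric]], symmetric]
  by (intro nn_integral_mono mult_right_mono ennreal_leI gauss_kernel_real_le assms) auto

section \<open>One-dimensional profiles and their Gaussian averages\<close>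

lemma nn_integral_has_integral_on:
  fixes f :: "'a::euclidean_space \<Rightarrow> real"
  assumes [measurable]: "f \<in> borel_measurable borel" "S \<in> sets borel"
    and "\<And>x. 0 \<le> f x" and I: "(f has_integral I) S"
  shows "(\<integral>\<^sup>+ x\<in>S. ennreal (f x) \<partial>lborel) = ennreal I"
proof -
  have "(\<lambda>x. f x * indicator S x) = (\<lambda>x. if x \<in> S then f x else 0)"
    by auto
  then have "((\<lambda>x. f x * indicator S x) has_integral I) UNIV"
    using I by (simp only: has_integral_restrict_UNIV)
  then have "(\<integral>\<^sup>+ x. ennreal (f x * indicator S x) \<partial>lborel) = ennreal I"
    using assms(3) by (intro nn_integral_has_integral_lborel) auto
  then show ?thesis
    using assms(3) by (simp add: ennreal_mult' ennreal_indicator)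
qed

lemma nn_integral_powr_from_0:
  assumes "a > -1" "c \<ge> 0"
  shows "(\<integral>\<^sup>+ r\<in>{0..c}. ennreal (r powr a) \<partial>lborel) = ennreal (c powr (a + 1) / (a + 1))"
  using has_integral_powr_from_0 [OF assms] by (intro nn_integral_has_integral_on) auto

lemma nn_integral_powr_to_inf:
  assumes "e < -1" "c > 0"
  shows "(\<integral>\<^sup>+ r\<in>{c..}. ennreal (r powr e) \<partial>lborel) = ennreal (- (c powr (e + 1)) / (e + 1))"
  using has_integral_powr_to_inf [OF assms] by (intro nn_integral_has_integral_on) auto

text \<open>The midpoint of the admissible exponents between -1 and 0: above -1 the profile is
  integrable at 0 and the total short-time exponent stays above -1; below 0 the total long-time
  exponent drops below -1.\<close>

definition rsqrt :: "real \<Rightarrow> ennreal" where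
  "rsqrt r = ennreal (indicator {0<..} r * r powr (-1/2))"

lemma rsqrt_measurable [measurable]: "rsqrt \<in> borel_measurable borel"
  unfolding rsqrt_def by measurable

text \<open>Cut at \<open>sqrt t\<close>. Up to the cut, the sup bound t^(-1/2) of the kernel meets
  the integral 2 t^(1/4) of the profile; elsewhere the profile is at most t^(-1/4) and the kernel
  has mass 1.\<close>

lemma nn_integral_gauss_kernel_rsqrt:
  assumes "t > 0"
  shows "(\<integral>\<^sup>+ r. ennreal (gauss_kernel t a r) * rsqrt r \<partial>lborel)
    \<le> ennreal (3 * t powr (-1/4))"
proof -
  define c where "c = sqrt t"
  have c: "c > 0" and ct: "c = t powr (1/2)" using assms by (auto simp: c_def powr_half_sqrt)
  have "ennreal (gauss_kernel t a r) * rsqrt r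
     \<le> ennreal (t powr (-1/2)) * (ennreal (r powr (-1/2)) * indicator {0..c} r)
       + ennreal (gauss_kernel t a r) * ennreal (c powr (-1/2))" for r
  proof (cases "0 < r \<and> r \<le> c")
    case True
    then show ?thesis
      using gauss_kernel_real_le [OF assms, of a r]
      by (intro add_increasing2) (auto simp: rsqrt_def intro!: mult_right_mono ennreal_leI)
  next
    case False
    then have "rsqrt r \<le> ennreal (c powr (-1/2))"
      using c by (auto simp: rsqrt_def indicator_def intro!: ennreal_leI powr_mono2')
    then show ?thesis
      by (intro add_increasing) (auto intro!: mult_left_mono)
  qed
  then have "(\<integral>\<^sup>+ r. ennreal (gauss_kernel t a r) * rsqrt r \<partial>lborel)
     \<le> (\<integral>\<^sup>+ r. ennreal (t powr (-1/2)) * (ennreal (r powr (-1/2)) * indicator {0..c} r)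
       + ennreal (gauss_kernel t a r) * ennreal (c powr (-1/2)) \<partial>lborel)"
    by (intro nn_integral_mono)
  also have "\<dots> = ennreal (t powr (-1/2)) * ennreal (c powr (1/2) / (1/2)) + ennreal (c powr (-1/2))"
    using c by (simp add: nn_integral_add nn_integral_cmult nn_integral_multc nn_integral_powr_from_0
        nn_integral_gauss_kernel_real assms)
  also have "\<dots> = ennreal (3 * t powr (-1/4))"
    unfolding ct by (simp add: powr_powr flip: ennreal_mult ennreal_plus powr_add)
  finally show ?thesis .
qed


text \<open>The function f of the outline. Step \<open>k\<close> has mass 2^(-k-1), but its p-th
  power integrates to 2^(k^2 (p-1) - (k+1) p), which is unbounded in \<open>k\<close> for every p >
  1.\<close>

definition spike :: "real \<Rightarrow> ennreal" where
  "spike r = (\<Sum>k. ennreal ((1/2) ^ Suc k * 2 ^ k\<^sup>2) * indicator {0<..<1 / 2 ^ k\<^sup>2} r)"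

lemma spike_measurable [measurable]: "spike \<in> borel_measurable borel"
  unfolding spike_def by measurable

lemma nn_integral_spike: "(\<integral>\<^sup>+ r. spike r \<partial>lborel) = 1"
proof -
  have "(\<integral>\<^sup>+ r. spike r \<partial>lborel) =
      (\<Sum>k. \<integral>\<^sup>+ r. ennreal ((1/2) ^ Suc k * 2 ^ k\<^sup>2) * indicator {0<..<1 / 2 ^ k\<^sup>2 :: real} r \<partial>lborel)"
    unfolding spike_def by (rule nn_integral_suminf) measurable
  also have "\<dots> = (\<Sum>k. ennreal ((1/2) ^ Suc k))"
    by (simp add: nn_integral_cmult_indicator flip: ennreal_mult)
  also have "\<dots> = ennreal 1"
    using power_half_series by (intro suminf_ennreal_eq) auto
  finally show ?thesis by simp
qed

lemma spike_ge:
  assumes "0 < r" "r < 1 / 2 ^ k\<^sup>2"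
  shows "ennreal ((1/2) ^ Suc k * 2 ^ k\<^sup>2) \<le> spike r"
proof -
  have "(\<Sum>i\<in>{k}. ennreal ((1/2) ^ Suc i * 2 ^ i\<^sup>2) * indicator {0<..<1 / 2 ^ i\<^sup>2} r) \<le> spike r"
    unfolding spike_def by (intro sum_le_suminf) auto
  then show ?thesis using assms by simp
qed

section \<open>The perturbation series of a nonnegative potential\<close>

lemma ennreal_lebesgue_integral_le:
  fixes f :: "'a \<Rightarrow> real"
  assumes "\<And>x. 0 \<le> f x"
  shows "ennreal (integral\<^sup>L M f) \<le> (\<integral>\<^sup>+ x. ennreal (f x) \<partial>M)"
proof (cases "integrable M f")
  case True
  then show ?thesis using assms by (simp add: nn_integral_eq_integral)
next
  \<comment> \<open>A nonintegrable function has Bochner integral 0 by default, so the inequality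
    persists.\<close>
  case False
  then show ?thesis by (simp add: not_integrable_integral_eq)
qed

lemma perturbation_term_nonneg:
  assumes "\<And>z. 0 \<le> V z"
  shows "0 \<le> perturbation_term V n t x y"
proof (induction n arbitrary: t x y)
  case 0
  then show ?case by (simp add: gauss_kernel_nonneg)
next
  case (Suc n)
  show ?case
    using assms Suc
    by (auto simp: set_lebesgue_integral_def gauss_kernel_nonneg real_of_ereal_pos intro!: integral_nonneg mult_nonneg_nonneg)
qed

text \<open>The preceding comparison of integrals passes through both integrations of the recursion,
  so upper bounds for the extended terms carry over to the real ones.\<close>

lemma perturbation_term_le_nn:
  fixes V :: "'a::euclidean_space \<Rightarrow> ereal"
  assumes "\<And>z. 0 \<le> V z"
  shows "ennreal (perturbation_term V n t x y) \<le> perturbation_term_nn (\<lambda>z. e2ennreal (V z)) n t x y"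
proof (induction n arbitrary: t x y)
  case 0
  then show ?case by simp
next
  case (Suc n)
  define F where "F s z = perturbation_term V n s x z * real_of_ereal (V z) * gauss_kernel (t - s) z y" for s z
  \<comment> \<open>Only an inequality: where \<open>V z\<close> is infinite, the left side is 0 by
    default.\<close>
  have V: "ennreal (real_of_ereal (V z)) \<le> e2ennreal (V z)" for z
    using assms [of z] by (cases "V z") (auto simp: ennreal.abs_eq [symmetric])
  have F: "0 \<le> F s z" for s z
    unfolding F_def using assms
    by (intro mult_nonneg_nonneg perturbation_term_nonneg real_of_ereal_pos gauss_kernel_nonneg)
  have "ennreal (perturbation_term V (Suc n) t x y)
      = ennreal (\<integral> s. indicator {0<..<t} s * (\<integral> z. F s z \<partial>lborel) \<partial>lborel)"
    by (simp add: F_def set_lebesgue_integral_def)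
  also have "\<dots> \<le> (\<integral>\<^sup>+ s. ennreal (indicator {0<..<t} s * (\<integral> z. F s z \<partial>lborel)) \<partial>lborel)"
    using F by (intro ennreal_lebesgue_integral_le) (simp add: integral_nonneg)
  also have "\<dots> = (\<integral>\<^sup>+ s\<in>{0<..<t}. ennreal (\<integral> z. F s z \<partial>lborel) \<partial>lborel)"
    by (intro nn_integral_cong) (auto simp: indicator_def)
  also have "\<dots> \<le> (\<integral>\<^sup>+ s\<in>{0<..<t}. (\<integral>\<^sup>+ z. ennreal (F s z) \<partial>lborel) \<partial>lborel)"
    using F by (intro nn_integral_mono mult_right_mono ennreal_lebesgue_integral_le) auto
  also have "\<dots> \<le> perturbation_term_nn (\<lambda>z. e2ennreal (V z)) (Suc n) t x y"
    unfolding F_def perturbation_term_nn.simps using assms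
    by (intro nn_integral_mono mult_right_mono)
       (auto simp: ennreal_mult gauss_kernel_nonneg perturbation_term_nonneg real_of_ereal_pos
         intro!: mult_mono Suc.IH V)
  finally show ?case .
qed

text \<open>Inserting the bound for term \<open>n\<close> into the recursion leaves
  \<open>q ^ n\<close> times the first term, to which \<open>first\<close> applies once
  more.\<close>

lemma perturbation_term_nn_le_power:
  fixes W :: "'a::euclidean_space \<Rightarrow> ennreal"
  assumes [measurable]: "W \<in> borel_measurable borel"
    and first: "\<And>t x y. t > 0 \<Longrightarrow>
      perturbation_term_nn W 1 t x y \<le> ennreal q * ennreal (gauss_kernel t x y)"
    and "t > 0"
  shows "perturbation_term_nn W n t x y \<le> ennreal q ^ n * ennreal (gauss_kernel t x y)"
  using \<open>t > 0\<close>
proof (induction n arbitrary: t x y)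
  case 0
  then show ?case by simp
next
  case (Suc n)
  have "perturbation_term_nn W (Suc n) t x y \<le>
      (\<integral>\<^sup>+ s\<in>{0<..<t}. (\<integral>\<^sup>+ z. ennreal q ^ n * (ennreal (gauss_kernel s x z) * W z
        * ennreal (gauss_kernel (t - s) z y)) \<partial>lborel) \<partial>lborel)"
    unfolding perturbation_term_nn.simps
    using Suc.IH by (intro nn_integral_mono)
      (auto simp: indicator_def mult.assoc [symmetric] intro!: nn_integral_mono mult_right_mono)
  also have "\<dots> = ennreal q ^ n * perturbation_term_nn W 1 t x y"
    by (simp add: nn_integral_cmult mult.assoc)
  also have "\<dots> \<le> ennreal q ^ n * (ennreal q * ennreal (gauss_kernel t x y))"
    by (intro mult_left_mono first Suc.prems) auto
  finally show ?case by (simp add: mult_ac)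
qed


section \<open>The potential and its first perturbation term\<close>

lemma prod_three_factors:
  assumes "finite A" "{a, b, c} \<subseteq> A" "a \<noteq> b" "a \<noteq> c" "b \<noteq> c"
    and "\<And>i. i \<in> A - {a, b, c} \<Longrightarrow> f i = 1"
  shows "prod f A = f a * f b * (f c :: 'b::comm_monoid_mult)"
proof -
  have "prod f A = prod f {a, b, c}"
    using assms by (intro prod.mono_neutral_right) auto
  then show ?thesis using assms by (simp add: mult.assoc)
qed

text \<open>For distinct basis vectors the potential is constant in all other coordinates. The
  factor 1/288 turns the bound 144 of the time integral into the ratio 1/2.\<close>

definition spiked_potential :: "'a \<Rightarrow> 'a \<Rightarrow> 'a \<Rightarrow> 'a::euclidean_space \<Rightarrow> ennreal" where
  "spiked_potential e1 e2 e3 z =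
     ennreal (1 / 288) * (spike (z \<bullet> e1) * indicator {0<..<1} (z \<bullet> e2) * rsqrt (z \<bullet> e3))"

lemma spiked_potential_measurable [measurable]: "spiked_potential e1 e2 e3 \<in> borel_measurable borel"
  unfolding spiked_potential_def by measurable

text \<open>Kernel and potential are both products over coordinates, so the integral factorises;
  each direction other than the three chosen ones contributes the Gaussian mass 1. The bound does
  not depend on the centre \<open>m\<close>.\<close>

lemma nn_integral_gauss_kernel_spiked_potential:
  fixes e1 e2 e3 m :: "'a::euclidean_space"
  assumes e: "{e1, e2, e3} \<subseteq> Basis" "e1 \<noteq> e2" "e1 \<noteq> e3" "e2 \<noteq> e3" and "t > 0"
  shows "(\<integral>\<^sup>+ z. ennreal (gauss_kernel t m z) * spiked_potential e1 e2 e3 z \<partial>lborel)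
    \<le> ennreal (1 / 288) * ennreal (3 * min (t powr (-3/4)) (t powr (-5/4)))"
proof -
  define w where "w b = (if b = e1 then spike else if b = e2 then indicator {0<..<1}
    else if b = e3 then rsqrt else (\<lambda>r. 1))" for b
  define G where "G b = (\<integral>\<^sup>+ r. ennreal (gauss_kernel t (m \<bullet> b) r) * w b r \<partial>lborel)" for b
  have w [measurable]: "w b \<in> borel_measurable borel" for b
    unfolding w_def by auto
  have "spike (z \<bullet> e1) * indicator {0<..<1} (z \<bullet> e2) * rsqrt (z \<bullet> e3) = (\<Prod>b\<in>Basis. w b (z \<bullet> b))" for z
    using e by (subst prod_three_factors [of _ e1 e2 e3]) (auto simp: w_def)
  then have "ennreal (gauss_kernel t m z) * (spike (z \<bullet> e1) * indicator {0<..<1} (z \<bullet> e2) * rsqrt (z \<bullet> e3))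
      = (\<Prod>b\<in>Basis. ennreal (gauss_kernel t (m \<bullet> b) (z \<bullet> b)) * w b (z \<bullet> b))" for z
    using \<open>t > 0\<close> by (simp add: gauss_kernel_eq_prod [of t m z] prod_ennreal gauss_kernel_nonneg prod.distrib)
  then have "(\<integral>\<^sup>+ z. ennreal (gauss_kernel t m z) * spiked_potential e1 e2 e3 z \<partial>lborel)
      = ennreal (1 / 288) * (\<integral>\<^sup>+ z. (\<Prod>b\<in>Basis. ennreal (gauss_kernel t (m \<bullet> b) (z \<bullet> b)) * w b (z \<bullet> b)) \<partial>lborel)"
    unfolding spiked_potential_def
    by (subst nn_integral_cmult [symmetric]) (auto simp: mult.left_commute [of _ "ennreal (1 / 288)"] intro!: nn_integral_cong)
  also have "(\<integral>\<^sup>+ z. (\<Prod>b\<in>Basis. ennreal (gauss_kernel t (m \<bullet> b) (z \<bullet> b)) * w b (z \<bullet> b)) \<partial>lborel) = prod G Basis"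
    unfolding G_def by (rule nn_integral_lborel_prod) auto
  also have "prod G Basis = G e1 * G e2 * G e3"
    using e \<open>t > 0\<close>
    by (intro prod_three_factors) (auto simp: G_def w_def nn_integral_gauss_kernel_real)
  also have "\<dots> \<le> ennreal (t powr (-1/2)) * ennreal (min 1 (t powr (-1/2))) * ennreal (3 * t powr (-1/4))"
  proof (intro mult_mono)
    show "G e1 \<le> ennreal (t powr (-1/2))"
      using nn_integral_gauss_kernel_le [OF \<open>t > 0\<close>, of spike "m \<bullet> e1"]
      by (simp add: G_def w_def nn_integral_spike)
    \<comment> \<open>Mass 1 of the kernel gives the bound for short times; its sup bound times the
      width 1 of the slab gives the one for long times.\<close>
    have "G e2 \<le> (\<integral>\<^sup>+ r. ennreal (gauss_kernel t (m \<bullet> e2) r) \<partial>lborel)"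
      using e by (auto simp: G_def w_def indicator_def intro!: nn_integral_mono)
    moreover have "G e2 \<le> ennreal (t powr (-1/2))"
      using nn_integral_gauss_kernel_le [OF \<open>t > 0\<close>, of "indicator {0<..<1}" "m \<bullet> e2"] e
      by (simp add: G_def w_def)
    ultimately show "G e2 \<le> ennreal (min 1 (t powr (-1/2)))"
      using \<open>t > 0\<close> by (simp add: nn_integral_gauss_kernel_real min_def)
    show "G e3 \<le> ennreal (3 * t powr (-1/4))"
      using nn_integral_gauss_kernel_rsqrt [OF \<open>t > 0\<close>, of "m \<bullet> e3"] e by (simp add: G_def w_def)
  qed auto
  also have "\<dots> = ennreal (3 * min (t powr (-3/4)) (t powr (-5/4)))"
  proof -
    have "t powr (-1/2) * min 1 (t powr (-1/2)) * (3 * t powr (-1/4))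
        = 3 * min (t powr (-1/2) * t powr (-1/4)) (t powr (-1/2) * t powr (-1/2) * t powr (-1/4))"
      using \<open>t > 0\<close> by (auto simp: min_def)
    also have "\<dots> = 3 * min (t powr (-3/4)) (t powr (-5/4))"
      unfolding powr_add [symmetric] by simp
    finally show ?thesis by (simp flip: ennreal_mult)
  qed
  finally show ?thesis
    by (simp add: mult_left_mono)
qed

text \<open>The bridge time is at least half of the smaller of \<open>s\<close> and
  \<open>t - s\<close>, so the integrand is dominated by \<open>K s + K (t - s)\<close> with
  \<open>K\<close> integrable on the line and independent of \<open>t\<close>.\<close>

lemma nn_integral_bridge_time_le:
  assumes "t > 0"
  shows "(\<integral>\<^sup>+ s\<in>{0<..<t}. ennreal (3 * min ((s * (t - s) / t) powr (-3/4)) ((s * (t - s) / t) powr (-5/4))) \<partial>lborel)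
    \<le> 144"
proof -
  define H where "H \<tau> = ennreal (3 * min (\<tau> powr (-3/4)) (\<tau> powr (-5/4)))" for \<tau> :: real
  \<comment> \<open>6 = 3 * 2 and 12 = 3 * 4 come from rounding 2^(3/4) up to 2 and 2^(5/4) up to 4.
    Both power integrals equal 4, so \<open>K\<close> has integral 24 + 48 = 72.\<close>
  define K where "K s = 6 * (ennreal (s powr (-3/4)) * indicator {0..1} s)
    + 12 * (ennreal (s powr (-5/4)) * indicator {1..} s)" for s :: real
  have [measurable]: "K \<in> borel_measurable borel" unfolding K_def by measurable
  have K: "H \<tau> \<le> K s" if "0 < s" "s / 2 \<le> \<tau>" for s \<tau>
  proof -
    have le: "\<tau> powr (-p) \<le> 2 powr p * s powr (-p)" if "p > 0" for p
    proof -
      have "\<tau> powr (-p) \<le> (s / 2) powr (-p)"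
        using that \<open>0 < s\<close> \<open>s / 2 \<le> \<tau>\<close> by (intro powr_mono2') auto
      also have "\<dots> = 2 powr p * s powr (-p)"
        using \<open>0 < s\<close> by (simp add: powr_divide powr_minus field_simps)
      finally show ?thesis .
    qed
    have "2 powr (3/4) \<le> (2::real) powr 1" "2 powr (5/4) \<le> (2::real) powr 2"
      by (intro powr_mono; simp)+
    then have "2 powr (3/4) * s powr (-3/4) \<le> 2 * s powr (-3/4)"
      "2 powr (5/4) * s powr (-5/4) \<le> 4 * s powr (-5/4)"
      by (auto intro!: mult_right_mono)
    with le [of "3/4"] le [of "5/4"]
    have *: "\<tau> powr (-3/4) \<le> 2 * s powr (-3/4)" "\<tau> powr (-5/4) \<le> 4 * s powr (-5/4)"
      by auto
    show ?thesis
    proof (cases "s \<le> 1")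
      case True
      have "H \<tau> \<le> ennreal (6 * s powr (-3/4))"
        using * unfolding H_def by (intro ennreal_leI) auto
      also have "\<dots> \<le> K s"
        using True that by (auto simp: K_def ennreal_mult intro!: add_increasing2)
      finally show ?thesis .
    next
      case False
      have "H \<tau> \<le> ennreal (12 * s powr (-5/4))"
        using * unfolding H_def by (intro ennreal_leI) auto
      also have "\<dots> \<le> K s"
        using False that by (auto simp: K_def ennreal_mult intro!: add_increasing)
      finally show ?thesis .
    qed
  qed
  have "H (s * (t - s) / t) \<le> K s + K (t - s)" if "0 < s" "s < t" for s
  proof (cases "s \<le> t / 2")
    case True
    then have "H (s * (t - s) / t) \<le> K s"
      using that by (intro K) (auto simp: field_simps)
    then show ?thesis by (simp add: add_increasing2)
  next
    case False
    then have "(t - s) * (1 / 2) \<le> (t - s) * (s / t)"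
      using that by (intro mult_left_mono) (auto simp: field_simps)
    then have "H (s * (t - s) / t) \<le> K (t - s)"
      using that by (intro K) (auto simp: mult.commute)
    then show ?thesis by (simp add: add_increasing)
  qed
  then have "(\<integral>\<^sup>+ s\<in>{0<..<t}. H (s * (t - s) / t) \<partial>lborel) \<le> (\<integral>\<^sup>+ s. K s + K (t - s) \<partial>lborel)"
    by (intro nn_integral_mono) (auto simp: indicator_def)
  also have "\<dots> = (\<integral>\<^sup>+ s. K s \<partial>lborel) + (\<integral>\<^sup>+ s. K (t - s) \<partial>lborel)"
    by (rule nn_integral_add) auto
  also have "(\<integral>\<^sup>+ s. K (t - s) \<partial>lborel) = (\<integral>\<^sup>+ s. K s \<partial>lborel)"
    using nn_integral_real_affine [of K "-1" t] by simp
  also have "(\<integral>\<^sup>+ s. K s \<partial>lborel) = 72"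
    unfolding K_def
    by (simp add: nn_integral_add nn_integral_cmult nn_integral_powr_from_0 nn_integral_powr_to_inf)
  finally show ?thesis by (simp add: H_def)
qed

text \<open>The bridge identity takes out \<open>gauss_kernel t x y\<close>; then \<open>x\<close>
  and \<open>y\<close> enter only through the centre \<open>m\<close>, and the bound uniform in
  \<open>m\<close> leaves an integral over \<open>s\<close> alone.\<close>

lemma perturbation_term_nn_spiked_potential_le:
  fixes e1 e2 e3 x y :: "'a::euclidean_space"
  assumes e: "{e1, e2, e3} \<subseteq> Basis" "e1 \<noteq> e2" "e1 \<noteq> e3" "e2 \<noteq> e3" and "t > 0"
  shows "perturbation_term_nn (spiked_potential e1 e2 e3) 1 t x y
    \<le> ennreal (1/2) * ennreal (gauss_kernel t x y)"
proof -
  define h where "h s = ennreal (3 * min ((s * (t - s) / t) powr (-3/4)) ((s * (t - s) / t) powr (-5/4)))" for s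
  define c where "c = ennreal (gauss_kernel t x y) * ennreal (1 / 288)"
  have "(\<integral>\<^sup>+ z. ennreal (gauss_kernel s x z) * spiked_potential e1 e2 e3 z * ennreal (gauss_kernel (t - s) z y) \<partial>lborel)
      \<le> c * h s" if s: "0 < s" "s < t" for s
  proof -
    define \<tau> m where "\<tau> = s * (t - s) / t" and "m = x + (s / t) *\<^sub>R (y - x)"
    have "\<tau> > 0" using that by (simp add: \<tau>_def)
    have "ennreal (gauss_kernel s x z) * spiked_potential e1 e2 e3 z * ennreal (gauss_kernel (t - s) z y)
       = ennreal (gauss_kernel t x y) * (ennreal (gauss_kernel \<tau> m z) * spiked_potential e1 e2 e3 z)" for z
    proof -
      have "ennreal (gauss_kernel s x z) * ennreal (gauss_kernel (t - s) z y)
          = ennreal (gauss_kernel t x y) * ennreal (gauss_kernel \<tau> m z)"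
        using gauss_kernel_bridge [OF s, of x z y]
        by (simp add: \<tau>_def m_def gauss_kernel_nonneg flip: ennreal_mult)
      then show ?thesis by (metis mult.assoc mult.commute)
    qed
    then have "(\<integral>\<^sup>+ z. ennreal (gauss_kernel s x z) * spiked_potential e1 e2 e3 z * ennreal (gauss_kernel (t - s) z y) \<partial>lborel)
       = ennreal (gauss_kernel t x y) * (\<integral>\<^sup>+ z. ennreal (gauss_kernel \<tau> m z) * spiked_potential e1 e2 e3 z \<partial>lborel)"
      by (simp add: nn_integral_cmult)
    also have "\<dots> \<le> ennreal (gauss_kernel t x y) * (ennreal (1 / 288) * ennreal (3 * min (\<tau> powr (-3/4)) (\<tau> powr (-5/4))))"
      by (intro mult_left_mono nn_integral_gauss_kernel_spiked_potential e \<open>\<tau> > 0\<close>) auto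
    finally show ?thesis by (simp add: c_def h_def \<tau>_def mult.assoc)
  qed
  then have "perturbation_term_nn (spiked_potential e1 e2 e3) 1 t x y \<le> (\<integral>\<^sup>+ s\<in>{0<..<t}. c * h s \<partial>lborel)"
    unfolding One_nat_def perturbation_term_nn.simps
    by (intro nn_integral_mono) (auto simp: indicator_def)
  also have "\<dots> = c * (\<integral>\<^sup>+ s\<in>{0<..<t}. h s \<partial>lborel)"
    by (simp add: mult.assoc nn_integral_cmult h_def)
  also have "\<dots> \<le> c * 144"
    unfolding h_def by (intro mult_left_mono nn_integral_bridge_time_le \<open>t > 0\<close>) auto
  also have "\<dots> = ennreal (1/2) * ennreal (gauss_kernel t x y)"
  proof -
    have "ennreal (1 / 288) * 144 = ennreal (1/2)"
      by (simp flip: ennreal_numeral ennreal_mult)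
    then show ?thesis by (simp add: c_def ac_simps)
  qed
  finally show ?thesis .
qed

section \<open>Failure of integrability\<close>

lemma abs_powr_enn2ereal_ge:
  assumes "0 \<le> a" "0 \<le> p" "ennreal a \<le> w"
  shows "ennreal (a powr p) \<le> abs_powr (enn2ereal w) p"
proof (cases w)
  case (real r)
  then show ?thesis
    using assms by (auto simp: abs_powr_def enn2ereal_ennreal intro!: ennreal_leI powr_mono2)
next
  case top
  then show ?thesis by (simp add: abs_powr_def)
qed

text \<open>The potential is bounded below on a box of volume \<open>R / 2 ^ k\<^sup>2\<close>, and
  \<open>S\<close> contains that box. Large \<open>R\<close> serves for the whole space, large
  \<open>k\<close> with \<open>R = 1\<close> for the unit cube.\<close>

lemma nn_integral_spiked_potential_ge:
  fixes e1 e2 e3 :: "'a::euclidean_space" and k :: nat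
  assumes e: "{e1, e2, e3} \<subseteq> Basis" "e1 \<noteq> e2" "e1 \<noteq> e3" "e2 \<noteq> e3"
    and "R > 0" "p \<ge> 0"
    and S: "\<And>z. (\<And>b. b \<in> Basis \<Longrightarrow> 0 < z \<bullet> b \<and>
      z \<bullet> b < (if b = e1 then 1 / 2 ^ k\<^sup>2 else if b = e3 then R else 1)) \<Longrightarrow> z \<in> S"
  shows "ennreal ((1 / 288 * ((1/2) ^ Suc k * 2 ^ k\<^sup>2) * R powr (-1/2)) powr p * (R / 2 ^ k\<^sup>2))
    \<le> (\<integral>\<^sup>+ z\<in>S. abs_powr (enn2ereal (spiked_potential e1 e2 e3 z)) p \<partial>lborel)"
proof -
  define l where "l b = (if b = e1 then 1 / 2 ^ k\<^sup>2 else if b = e3 then R else 1)" for b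
  define u where "u = (\<Sum>b\<in>Basis. l b *\<^sub>R b)"
  define a where "a = 1 / 288 * ((1/2) ^ Suc k * 2 ^ k\<^sup>2) * R powr (-1/2)"
  have u: "u \<bullet> b = l b" if "b \<in> Basis" for b
    using that by (simp add: u_def)
  have "prod l Basis = l e1 * l e2 * l e3"
    using e by (intro prod_three_factors) (auto simp: l_def)
  then have vol: "emeasure lborel (box 0 u) = ennreal (R / 2 ^ k\<^sup>2)"
    using e \<open>R > 0\<close> by (subst emeasure_lborel_box) (auto simp: u l_def)
  have "ennreal (a powr p) * indicator (box 0 u) z
      \<le> abs_powr (enn2ereal (spiked_potential e1 e2 e3 z)) p * indicator S z" for z
  proof (cases "z \<in> box 0 u")
    case True
    then have z: "0 < z \<bullet> b" "z \<bullet> b < l b" if "b \<in> Basis" for b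
      using that by (auto simp: box_def u)
    then have "z \<in> S"
      unfolding l_def by (intro S) auto
    have "R powr (-1/2) \<le> (z \<bullet> e3) powr (-1/2)"
      using z [of e3] e by (intro powr_mono2') (auto simp: l_def)
    then have "ennreal (R powr (-1/2)) \<le> rsqrt (z \<bullet> e3)"
      using z [of e3] e by (simp add: rsqrt_def ennreal_leI)
    moreover have "ennreal ((1/2) ^ Suc k * 2 ^ k\<^sup>2) \<le> spike (z \<bullet> e1)"
      using z [of e1] e by (intro spike_ge) (auto simp: l_def)
    moreover have "z \<bullet> e2 \<in> {0<..<1}"
      using z [of e2] e by (auto simp: l_def)
    ultimately have "ennreal (1 / 288) * (ennreal ((1/2) ^ Suc k * 2 ^ k\<^sup>2) * ennreal (R powr (-1/2)))
        \<le> spiked_potential e1 e2 e3 z"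
      unfolding spiked_potential_def by (auto intro!: mult_left_mono mult_mono simp del: power_Suc)
    then have "ennreal a \<le> spiked_potential e1 e2 e3 z"
      by (simp add: a_def mult.assoc flip: ennreal_mult)
    then show ?thesis
      using \<open>z \<in> S\<close> \<open>p \<ge> 0\<close> True by (auto intro!: abs_powr_enn2ereal_ge simp: a_def)
  qed auto
  then have "(\<integral>\<^sup>+ z. ennreal (a powr p) * indicator (box 0 u) z \<partial>lborel)
      \<le> (\<integral>\<^sup>+ z\<in>S. abs_powr (enn2ereal (spiked_potential e1 e2 e3 z)) p \<partial>lborel)"
    by (intro nn_integral_mono)
  then show ?thesis
    using \<open>R > 0\<close> by (simp add: nn_integral_cmult_indicator vol a_def flip: ennreal_mult)
qed

text \<open>With \<open>k = 0\<close> and \<open>p = 1\<close> the box estimate is R^(-1/2) * R /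
  576, which grows without bound as the box is lengthened along \<open>e3\<close>.\<close>

lemma spiked_potential_not_L1:
  fixes e1 e2 e3 :: "'a::euclidean_space"
  assumes e: "{e1, e2, e3} \<subseteq> Basis" "e1 \<noteq> e2" "e1 \<noteq> e3" "e2 \<noteq> e3"
  shows "(\<lambda>z. enn2ereal (spiked_potential e1 e2 e3 z)) \<notin> Lp_on 1 UNIV"
proof
  assume "(\<lambda>z. enn2ereal (spiked_potential e1 e2 e3 z)) \<in> Lp_on 1 UNIV"
  then obtain B where B: "(\<integral>\<^sup>+ z. abs_powr (enn2ereal (spiked_potential e1 e2 e3 z)) 1 \<partial>lborel) = ennreal B" "0 \<le> B"
    by (auto simp: Lp_on_def less_top_ennreal)
  have le: "1 / 576 * R powr (1/2) \<le> B" if "R > 0" for R :: real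
  proof -
    have "R powr (-1/2) * R = R powr (-1/2) * R powr 1" using that by simp
    also have "\<dots> = R powr (1/2)" unfolding powr_add [symmetric] by simp
    finally show ?thesis
      using nn_integral_spiked_potential_ge [OF e that, of 1 0 UNIV] B that by simp
  qed
  have "filterlim (\<lambda>R::real. 1 / 576 * R powr (1/2)) at_top at_top"
    by real_asymp
  then have "\<forall>\<^sub>F R in at_top. B < 1 / 576 * R powr (1/2)"
    by (simp add: filterlim_at_top_dense)
  then have "\<forall>\<^sub>F R in at_top. B < 1 / 576 * R powr (1/2) \<and> (R::real) > 0"
    using eventually_gt_at_top by (rule eventually_conj)
  then obtain R :: real where "B < 1 / 576 * R powr (1/2)" "R > 0"
    using eventually_happens' [OF trivial_limit_at_top_linorder] by blast
  with le [of R] show False by simp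
qed

text \<open>The unit cube is a bad compact set for every p > 1: in the exponent of the box estimate
  the quadratic term k^2 (p - 1) outgrows the linear loss k p.\<close>

lemma spiked_potential_not_Lp_loc:
  fixes e1 e2 e3 :: "'a::euclidean_space"
  assumes e: "{e1, e2, e3} \<subseteq> Basis" "e1 \<noteq> e2" "e1 \<noteq> e3" "e2 \<noteq> e3" and "p > 1"
  shows "(\<lambda>z. enn2ereal (spiked_potential e1 e2 e3 z)) \<notin> Lp_loc p"
proof
  assume "(\<lambda>z. enn2ereal (spiked_potential e1 e2 e3 z)) \<in> Lp_loc p"
  then have "(\<lambda>z. enn2ereal (spiked_potential e1 e2 e3 z)) \<in> Lp_on p (cbox 0 One)"
    by (simp add: Lp_loc_def)
  then obtain B where B: "(\<integral>\<^sup>+ z\<in>cbox 0 One. abs_powr (enn2ereal (spiked_potential e1 e2 e3 z)) p \<partial>lborel) = ennreal B" "0 \<le> B"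
    by (auto simp: Lp_on_def less_top_ennreal)
  have le: "(1 / 576) powr p * 2 powr (real k ^ 2 * (p - 1) - real k * p) \<le> B" for k :: nat
  proof -
    have "z \<bullet> b \<le> 1" if "z \<bullet> b < (if b = e1 then 1 / 2 ^ k\<^sup>2 else if b = e3 then 1 else 1)" for z b :: 'a
    proof -
      have "(if b = e1 then 1 / 2 ^ k\<^sup>2 else if b = e3 then 1 else 1) \<le> (1::real)" by simp
      with that show ?thesis by linarith
    qed
    then have "ennreal ((1 / 288 * ((1/2) ^ Suc k * 2 ^ k\<^sup>2) * 1 powr (-1/2)) powr p * (1 / 2 ^ k\<^sup>2)) \<le> ennreal B"
      unfolding B(1) [symmetric] using e \<open>p > 1\<close>
      by (intro nn_integral_spiked_potential_ge) (auto simp: cbox_def less_imp_le)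
    then have "(1 / 288 * ((1/2) ^ Suc k * 2 ^ k\<^sup>2)) powr p * (1 / 2 ^ k\<^sup>2) \<le> B"
      using B(2) by simp
    \<comment> \<open>The extra 1/2 in \<open>(1/2) ^ Suc k\<close> is absorbed in the constant
      1/576.\<close>
    moreover have "1 / 288 * ((1/2) ^ Suc k * 2 ^ k\<^sup>2) = 1 / 576 * 2 powr (real k ^ 2 - real k)"
      by (simp add: powr_diff powr_realpow field_simps power_one_over flip: powr_realpow of_nat_power)
    moreover have "1 / 2 ^ k\<^sup>2 = 2 powr (- (real k ^ 2))"
      by (simp add: powr_minus powr_realpow field_simps flip: of_nat_power)
    ultimately have "(1 / 576) powr p * (2 powr ((real k ^ 2 - real k) * p) * 2 powr (- (real k ^ 2))) \<le> B"
      by (simp only: powr_mult powr_powr mult.assoc)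
    then show ?thesis
      unfolding powr_add [symmetric] by (simp add: algebra_simps)
  qed
  have "filterlim (\<lambda>k::nat. (1 / 576) powr p * 2 powr (real k ^ 2 * (p - 1) - real k * p)) at_top sequentially"
    using \<open>p > 1\<close> by real_asymp
  then have "\<forall>\<^sub>F k::nat in sequentially. B < (1 / 576) powr p * 2 powr (real k ^ 2 * (p - 1) - real k * p)"
    by (simp only: filterlim_at_top_dense)
  then obtain k :: nat where "B < (1 / 576) powr p * 2 powr (real k ^ 2 * (p - 1) - real k * p)"
    using eventually_happens' [OF sequentially_bot] by blast
  with le [of k] show False by simp
qed

section \<open>Two-sided bounds and conclusion\<close>

lemma schroedinger_perturbation_bounds:
  fixes V :: "'a::euclidean_space \<Rightarrow> ereal"
  assumes [measurable]: "V \<in> borel_measurable borel" and V: "\<And>z. 0 \<le> V z" and q: "0 \<le> q" "q < 1"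
    and first: "\<And>t x y. t > 0 \<Longrightarrow> perturbation_term_nn (\<lambda>z. e2ennreal (V z)) 1 t x y
      \<le> ennreal q * ennreal (gauss_kernel t x y)"
  shows "perturbation_series_converges_absolutely V"
    and "t > 0 \<Longrightarrow> gauss_kernel t x y \<le> schroedinger_perturbation V t x y"
    and "t > 0 \<Longrightarrow> schroedinger_perturbation V t x y \<le> gauss_kernel t x y / (1 - q)"
proof -
  have nn: "perturbation_term_nn (\<lambda>z. e2ennreal (V z)) n t x y \<le> ennreal (q ^ n * gauss_kernel t x y)"
    if "t > 0" for n t x y
    using perturbation_term_nn_le_power [OF _ first that, of n x y] q
    by (simp add: ennreal_mult ennreal_power gauss_kernel_nonneg)
  have geo: "(\<lambda>n. q ^ n * gauss_kernel t x y) sums (gauss_kernel t x y / (1 - q))" for t x y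
    using sums_mult2 [OF geometric_sums, of q "gauss_kernel t x y"] q by simp
  have "\<bar>V z\<bar> = V z" for z using V [of z] by simp
  moreover have "(\<Sum>n. perturbation_term_nn (\<lambda>z. e2ennreal (V z)) n t x y) < \<infinity>" if "t > 0" for t x y
  proof -
    have "(\<Sum>n. perturbation_term_nn (\<lambda>z. e2ennreal (V z)) n t x y) \<le> (\<Sum>n. ennreal (q ^ n * gauss_kernel t x y))"
      using that by (intro suminf_le nn) auto
    also have "\<dots> = ennreal (gauss_kernel t x y / (1 - q))"
      using q by (intro suminf_ennreal_eq geo) (simp add: gauss_kernel_nonneg)
    finally show ?thesis by (simp add: le_less_trans)
  qed
  ultimately show "perturbation_series_converges_absolutely V"
    unfolding perturbation_series_converges_absolutely_def by simp
  assume "t > 0"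
  have le: "perturbation_term V n t x y \<le> q ^ n * gauss_kernel t x y" for n
    using order_trans [OF perturbation_term_le_nn [OF V] nn [OF \<open>t > 0\<close>], of n x y] q
    by (simp add: gauss_kernel_nonneg)
  have nonneg: "0 \<le> perturbation_term V n t x y" for n
    by (rule perturbation_term_nonneg [OF V])
  \<comment> \<open>The real \<open>suminf\<close> is informative only for summable sequences; the
    geometric majorant supplies this.\<close>
  have summable: "summable (\<lambda>n. perturbation_term V n t x y)"
    using le nonneg by (intro summable_comparison_test' [OF sums_summable [OF geo [of t x y]]]) auto
  \<comment> \<open>The lower bound keeps only the zeroth term, the kernel itself.\<close>
  have "(\<Sum>n\<in>{0}. perturbation_term V n t x y) \<le> schroedinger_perturbation V t x y"
    unfolding schroedinger_perturbation_def by (intro sum_le_suminf summable nonneg) auto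
  then show "gauss_kernel t x y \<le> schroedinger_perturbation V t x y" by simp
  show "schroedinger_perturbation V t x y \<le> gauss_kernel t x y / (1 - q)"
    unfolding schroedinger_perturbation_def sums_unique [OF geo]
    by (intro suminf_le le summable sums_summable [OF geo])
qed

theorem corollary3p4:
  assumes "CARD('n::finite) \<ge> 3"
  shows "\<exists>V :: real ^ 'n \<Rightarrow> ereal.
    V \<in> borel_measurable borel \<and>
    perturbation_series_converges_absolutely V \<and>
    (\<exists>c1 c2 :: real. 0 < c1 \<and> c1 \<le> c2 \<and>
      (\<forall>t>0. \<forall>x y.
         c1 \<le> schroedinger_perturbation V t x y / gauss_kernel t x y \<and>
         schroedinger_perturbation V t x y / gauss_kernel t x y \<le> c2)) \<and>
    V \<notin> Lp_on 1 UNIV \<union> (\<Union>p\<in>{1<..}. Lp_loc p)"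
proof -
  have "3 \<le> card (Basis :: (real ^ 'n) set)" using assms by simp
  then obtain T :: "(real ^ 'n) set" where "T \<subseteq> Basis" "card T = 3"
    using obtain_subset_with_card_n by metis
  then obtain e1 e2 e3 :: "real ^ 'n"
    where e: "{e1, e2, e3} \<subseteq> Basis" "e1 \<noteq> e2" "e1 \<noteq> e3" "e2 \<noteq> e3"
    by (metis card_3_iff)
  define V where "V z = enn2ereal (spiked_potential e1 e2 e3 z)" for z
  have V [measurable]: "V \<in> borel_measurable borel" unfolding V_def by measurable
  have nonneg: "0 \<le> V z" for z by (simp add: V_def)
  have first: "perturbation_term_nn (\<lambda>z. e2ennreal (V z)) 1 t x y \<le> ennreal (1/2) * ennreal (gauss_kernel t x y)"
    if "t > 0" for t x y
    using perturbation_term_nn_spiked_potential_le [OF e that] by (simp add: V_def)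
  \<comment> \<open>Here \<open>q = 1/2\<close>, hence the constants 1 and 1 / (1 - 1/2) =
    2.\<close>
  note bounds = schroedinger_perturbation_bounds [OF V nonneg _ _ first, simplified]
  have "1 \<le> schroedinger_perturbation V t x y / gauss_kernel t x y \<and>
      schroedinger_perturbation V t x y / gauss_kernel t x y \<le> 2" if "t > 0" for t x y
    using bounds(2,3) [OF that, of x y] gauss_kernel_pos [OF that, of x y] by (simp add: field_simps)
  moreover have "V \<notin> Lp_on 1 UNIV \<union> (\<Union>p\<in>{1<..}. Lp_loc p)"
    using spiked_potential_not_L1 [OF e] spiked_potential_not_Lp_loc [OF e] by (auto simp: V_def [abs_def])
  ultimately show ?thesis
    using V bounds(1) by (intro exI [of _ V] conjI exI [of _ 1] exI [of _ 2]) auto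
qed

end
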